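(* Let $d\ge 1$ be an integer and $q\in[0,1)$. There exists a constant $C$ depending only on $d$ and $q$ such that for every interval $I=(a,b]$ with $a<b$ real, every interval filtration $(\mathscr F_n)_{n\ge1}$ on $I^d$ and every $f\in L^1(I^d)$, the maximal function $$\mathscr M f(x)=\sup_{n\ge 1}\ \sum_{A\in\mathcal A(\mathscr F_n)} \frac{q^{d_n(A,A_n(x))}}{|\mathrm{re}(A\cup A_n(x))|}\int_A |f|\,d\lambda^d,\qquad x\in I^d,$$ satisfies $$|\{x\in I^d:\ \mathscr M f(x)>t\}|\le \frac{C}{t}\,\|f\|_{L^1(I^d)},\qquad t>0.$$
   Context: Let $I=(a,b]$ with $a<b$ real. An interval $\sigma$-algebra on $I$ is a $\sigma$-algebra generated by a partition of $I$ into finitely many intervals of the form $(c,c']$ with $c<c'$. An interval filtration on $I^d$ is a sequence $\mathscr F_n=\mathscr F_n^1\otimes\cdots\otimes\mathscr F_n^d$, $n\ge1$, where for each $\ell$, $(\mathscr F_n^\ell)_n$ is an increasing sequence of interval $\sigma$-algebras on $I$. The atoms of $\mathscr F_n$ are the rectangles $A_1\times\cdots\times A_d$ with $A_\ell$ an atom of $\mathscr F_n^\ell$; the finite set of atoms is denoted $\mathcal A(\mathscr F_n)$. Number the atoms of each $\mathscr F_n^\ell$ from left to right by consecutive integers; this indexes the atoms of $\mathscr F_n$ as $I_{n,i}$ by multi-indices $i=(i_1,\dots,i_d)\in\mathbb Z^d$. For $x\in I^d$, $A_n(x)$ is the atom of $\mathscr F_n$ containing $x$. For atoms $A=I_{n,i}$,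 $B=I_{n,j}$ put $d_n(A,B)=|i-j|_1=\sum_{\ell}|i_\ell-j_\ell|$. For a set $S$, $\mathrm{re}(S)$ is the smallest axis-parallel rectangle containing $S$. $|\cdot|=\lambda^d$ is $d$-dimensional Lebesgue measure, and $0^0=1$. *)

theory Defs
  imports "HOL-Analysis.Analysis"
begin

text \<open>\<sigma>-algebras are represented by their families of measurable sets, as in \<^const>\<open>sigma_sets\<close>.\<close>

definition interval_sigma_algebra :: "real \<Rightarrow> real \<Rightarrow> real set set \<Rightarrow> bool" where
  "interval_sigma_algebra a b M \<longleftrightarrow>
     (\<exists>P. finite P \<and> partition_on {a<..b} P \<and>
          (\<forall>A\<in>P. \<exists>c c'. c < c' \<and> A = {c<..c'}) \<and>
          M = sigma_sets {a<..b} P)"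

definition atoms :: "'a set set \<Rightarrow> 'a set set" where
  "atoms M = {A \<in> M. A \<noteq> {} \<and> (\<forall>B\<in>M. B \<subseteq> A \<longrightarrow> B = {} \<or> B = A)}"

definition cart_box :: "('n \<Rightarrow> real set) \<Rightarrow> (real^'n) set" where
  "cart_box J = {x. \<forall>l. x $ l \<in> J l}"

definition cube :: "real \<Rightarrow> real \<Rightarrow> (real^'n) set" where
  "cube a b = cart_box (\<lambda>_. {a<..b})"

definition prod_sigma_algebra :: "real \<Rightarrow> real \<Rightarrow> ('n \<Rightarrow> real set set) \<Rightarrow> (real^'n) set set" where
  "prod_sigma_algebra a b M = sigma_sets (cube a b) {cart_box J |J. \<forall>l. J l \<in> M l}"

text \<open>An interval filtration is given by its coordinate filtrations: \<open>F n l\<close> is the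
  \<open>n\<close>-th \<sigma>-algebra in direction \<open>l\<close>, and \<open>prod_sigma_algebra a b (F n)\<close> is the \<open>n\<close>-th
  \<sigma>-algebra on the cube. Time starts at 1; \<open>F 0\<close> is irrelevant.\<close>

definition interval_filtration :: "real \<Rightarrow> real \<Rightarrow> (nat \<Rightarrow> 'n \<Rightarrow> real set set) \<Rightarrow> bool" where
  "interval_filtration a b F \<longleftrightarrow>
     (\<forall>l. (\<forall>n\<ge>1. interval_sigma_algebra a b (F n l)) \<and>
          (\<forall>m\<ge>1. \<forall>n\<ge>m. F m l \<subseteq> F n l))"

definition atom_at :: "'a set set \<Rightarrow> 'a \<Rightarrow> 'a set" where
  "atom_at M x = (THE A. A \<in> atoms M \<and> x \<in> A)"

text \<open>The left-to-right position of the atom \<open>A\<close> among the atoms of \<open>M\<close>, counted from 0.\<close>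

definition atom_index :: "real set set \<Rightarrow> real set \<Rightarrow> int" where
  "atom_index M A = int (card {B \<in> atoms M. \<forall>x\<in>B. \<forall>y\<in>A. x < y})"

text \<open>The \<open>l\<close>-th factor of a product atom is its projection to the \<open>l\<close>-th coordinate.\<close>

definition multi_index :: "('n \<Rightarrow> real set set) \<Rightarrow> (real^'n) set \<Rightarrow> 'n \<Rightarrow> int" where
  "multi_index M A l = atom_index (M l) ((\<lambda>x. x $ l) ` A)"

definition atom_dist :: "('n::finite \<Rightarrow> real set set) \<Rightarrow> (real^'n) set \<Rightarrow> (real^'n) set \<Rightarrow> nat" where
  "atom_dist M A B = nat (\<Sum>l\<in>UNIV. \<bar>multi_index M A l - multi_index M B l\<bar>)"

definition rectangle :: "(real^'n) set \<Rightarrow> bool" where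
  "rectangle R \<longleftrightarrow> (\<exists>J. (\<forall>l. is_interval (J l)) \<and> R = cart_box J)"

definition re :: "(real^'n) set \<Rightarrow> (real^'n) set" where
  "re S = rectangle hull S"

definition maximal_fun ::
  "real \<Rightarrow> real \<Rightarrow> real \<Rightarrow> (nat \<Rightarrow> 'n::finite \<Rightarrow> real set set) \<Rightarrow> (real^'n \<Rightarrow> real) \<Rightarrow> real^'n \<Rightarrow> ennreal" where
  "maximal_fun q a b F f x =
     (SUP n\<in>{1..}. ennreal
        (\<Sum>A\<in>atoms (prod_sigma_algebra a b (F n)).
           q ^ atom_dist (F n) A (atom_at (prod_sigma_algebra a b (F n)) x) /
           measure lebesgue (re (A \<union> atom_at (prod_sigma_algebra a b (F n)) x)) *
           (LINT y:A|lebesgue. \<bar>f y\<bar>)))"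

lemma atoms_sigma_sets:
  assumes G: "G \<subseteq> Pow \<Omega>" and R: "R \<subseteq> sigma_sets \<Omega> G" and cover: "\<Union>R = \<Omega>" and ne: "{} \<notin> R"
    and split: "\<And>A B. A \<in> R \<Longrightarrow> B \<in> G \<Longrightarrow> A \<subseteq> B \<or> A \<inter> B = {}"
  shows "atoms (sigma_sets \<Omega> G) = R"
proof -
  have split': "A \<subseteq> B \<or> A \<inter> B = {}" if "A \<in> R" "B \<in> sigma_sets \<Omega> G" for A B
    using that(2)
  proof (induction rule: sigma_sets.induct)
    case (Basic B) then show ?case using split that(1) by blast
  next
    case Empty then show ?case by simp
  next
    case (Compl B) then show ?case using cover that(1) by blast
  next
    case (Union B) then show ?case by blast
  qed
  show ?thesis
  proof (intro equalityI subsetI)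
    fix X assume X: "X \<in> atoms (sigma_sets \<Omega> G)"
    then have XS: "X \<in> sigma_sets \<Omega> G" and "X \<noteq> {}" by (auto simp: atoms_def)
    then obtain x where x: "x \<in> X" by blast
    have "x \<in> \<Omega>" using sigma_sets_into_sp[OF G XS] x by blast
    then obtain A where A: "A \<in> R" "x \<in> A" using cover by blast
    then have "A \<subseteq> X" using split'[OF A(1) XS] x by blast
    then have "A = X" using X A R by (auto simp: atoms_def)
    then show "X \<in> R" using A by simp
  next
    fix A assume A: "A \<in> R"
    then show "A \<in> atoms (sigma_sets \<Omega> G)"
      unfolding atoms_def using R ne split'[OF A] by blast
  qed
qed

lemma atoms_sigma_sets_partition:
  assumes "partition_on \<Omega> P"
  shows "atoms (sigma_sets \<Omega> P) = P"
proof (rule atoms_sigma_sets)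
  show "P \<subseteq> Pow \<Omega>" "\<Union>P = \<Omega>" "{} \<notin> P"
    using assms by (auto simp: partition_on_def)
  show "A \<subseteq> B \<or> A \<inter> B = {}" if "A \<in> P" "B \<in> P" for A B
    using assms that by (auto simp: partition_on_def disjoint_def)
qed auto

lemma atoms_prod_sigma_algebra:
  fixes M :: "'n::finite \<Rightarrow> real set set"
  assumes "\<And>l. interval_sigma_algebra a b (M l)"
  shows "atoms (prod_sigma_algebra a b M) = {cart_box J |J. \<forall>l. J l \<in> atoms (M l)}"
proof -
  have "\<forall>l. \<exists>P. partition_on {a<..b} P \<and> M l = sigma_sets {a<..b} P"
    using assms unfolding interval_sigma_algebra_def by blast
  then obtain P where P: "\<And>l. partition_on {a<..b} (P l)"
    and M: "\<And>l. M l = sigma_sets {a<..b} (P l)" by metis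
  have at: "atoms (M l) = P l" for l using atoms_sigma_sets_partition[OF P] M by simp
  have PM: "A \<in> M l" if "A \<in> P l" for A l using that M by auto
  have PP: "P l \<subseteq> Pow {a<..b}" for l using P[of l] by (auto simp: partition_on_def)
  have MS: "A \<subseteq> {a<..b}" if "A \<in> M l" for A l
    using sigma_sets_into_sp[OF PP] that M by auto
  show ?thesis unfolding prod_sigma_algebra_def
  proof (rule atoms_sigma_sets)
    show "{cart_box J |J. \<forall>l. J l \<in> M l} \<subseteq> Pow (cube a b)"
      using MS by (fastforce simp: cart_box_def cube_def)
    show "{cart_box J |J. \<forall>l. J l \<in> atoms (M l)}
        \<subseteq> sigma_sets (cube a b) {cart_box J |J. \<forall>l. J l \<in> M l}"
      using PM at by blast
    show "\<Union> {cart_box J |J. \<forall>l. J l \<in> atoms (M l)} = cube a b"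
    proof (intro equalityI subsetI)
      fix x assume "x \<in> \<Union> {cart_box J |J. \<forall>l. J l \<in> atoms (M l)}"
      then show "x \<in> cube a b" using PP at by (fastforce simp: cart_box_def cube_def)
    next
      fix x :: "real^'n" assume "x \<in> cube a b"
      then have "x $ l \<in> {a<..b}" for l by (simp add: cart_box_def cube_def)
      then have "x $ l \<in> \<Union>(P l)" for l using partition_onD1[OF P[of l]] by metis
      then have "\<forall>l. \<exists>A. A \<in> P l \<and> x $ l \<in> A" by blast
      then obtain J where "\<And>l. J l \<in> P l \<and> x $ l \<in> J l" by metis
      then show "x \<in> \<Union> {cart_box J |J. \<forall>l. J l \<in> atoms (M l)}"
        unfolding at by (auto simp: cart_box_def)
    qed
    show "{} \<notin> {cart_box J |J. \<forall>l. J l \<in> atoms (M l)}"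
    proof
      assume "{} \<in> {cart_box J |J. \<forall>l. J l \<in> atoms (M l)}"
      then obtain J where J: "cart_box J = {}" "\<forall>l. J l \<in> atoms (M l)" by auto
      then have "\<forall>l. \<exists>y. y \<in> J l" by (auto simp: atoms_def)
      then obtain y where "\<And>l. y l \<in> J l" by metis
      then have "(\<chi> l. y l) \<in> cart_box J" by (simp add: cart_box_def)
      then show False using J by simp
    qed
    fix A B
    assume "A \<in> {cart_box J |J. \<forall>l. J l \<in> atoms (M l)}" "B \<in> {cart_box J |J. \<forall>l. J l \<in> M l}"
    then obtain J K where J: "A = cart_box J" "\<And>l. J l \<in> atoms (M l)"
      and K: "B = cart_box K" "\<And>l. K l \<in> M l" by auto
    have "J l \<subseteq> K l \<or> J l \<inter> K l = {}" for l
    proof -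
      interpret sigma_algebra "{a<..b}" "M l"
        unfolding M by (rule sigma_algebra_sigma_sets[OF PP])
      have JM: "J l \<in> M l" using J(2)[of l] by (simp add: atoms_def)
      have "J l \<inter> K l \<in> M l" by (rule Int[OF JM K(2)])
      then show ?thesis using J(2)[of l] unfolding atoms_def by fastforce
    qed
    then consider "\<And>l. J l \<subseteq> K l" | l where "J l \<inter> K l = {}" by blast
    then show "A \<subseteq> B \<or> A \<inter> B = {}"
    proof cases
      case 1
      then show ?thesis unfolding J(1) K(1) cart_box_def by blast
    next
      case 2
      then show ?thesis unfolding J(1) K(1) cart_box_def by blast
    qed
  qed
qed

end

theory Submission
  imports Defs
begin

text \<open>Fix an offset \<open>k\<close> and a weight \<open>w\<close>, and consider the pairs of cells \<open>A\<close>, \<open>B\<close> of the same level whose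
  indices differ by \<open>k\<close> and for which \<open>|re (B \<union> A)| \<le> w \<integral>\<^sub>B |f|\<close>. Going through the levels in order of time,
  select a pair whenever its \<open>B\<close> is disjoint from those selected before. For a pair \<open>A'\<close>, \<open>B'\<close> that is left
  out, \<open>B'\<close> lies in an earlier selected \<open>B\<close>, and then \<open>A' \<subseteq> re (B \<union> A)\<close>: refining a partition only
  increases index distances, so \<open>k\<close> steps from \<open>B'\<close> on the finer level do not lead beyond \<open>A\<close>. Hence the
  union of all the \<open>A\<close> has measure at most \<open>w \<parallel>f\<parallel>\<close>, whatever \<open>k\<close> is.

  Let \<open>q = r\<^sup>2\<close>, and let \<open>S = (2 / (1 - r))\<^sup>d\<close>, a bound for the sum of all \<open>r\<^bsup>|k|\<^esup>\<close>. If the sum over \<open>B\<close>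
  in the maximal function exceeds \<open>t\<close> on \<open>A\<close>, then comparison with the sum of the \<open>r\<^bsup>|k|\<^esup>\<close> gives a single \<open>B\<close>
  that contributes more than \<open>t r\<^bsup>|k|\<^esup> / S\<close>. Cancelling one of the two factors \<open>r\<^bsup>|k|\<^esup>\<close> of \<open>q\<^bsup>|k|\<^esup>\<close>, the pair
  satisfies the condition above with \<open>w = S r\<^bsup>|k|\<^esup> / t\<close>. Summing over \<open>k\<close> gives the constant \<open>S\<^sup>2\<close>.\<close>

section \<open>Counting the points of a finite set below a threshold\<close>

definition count_below :: "'a::linorder set \<Rightarrow> 'a \<Rightarrow> int" where
  "count_below E x = int (card {e \<in> E. e < x})"

lemma count_below_add_card_between:
  assumes "finite E" "x \<le> y"
  shows "count_below E y = count_below E x + int (card (E \<inter> {x..<y}))"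
proof -
  have "{e \<in> E. e < y} = {e \<in> E. e < x} \<union> (E \<inter> {x..<y})"
    using assms(2) by auto
  moreover have "card ({e \<in> E. e < x} \<union> (E \<inter> {x..<y})) = card {e \<in> E. e < x} + card (E \<inter> {x..<y})"
    using assms(1) by (intro card_Un_disjoint) auto
  ultimately show ?thesis
    by (simp add: count_below_def)
qed

lemma count_below_mono:
  assumes "finite E" "x \<le> y"
  shows "count_below E x \<le> count_below E y"
  using count_below_add_card_between[OF assms] by simp

lemma count_below_eq_iff:
  assumes "finite E" "x \<le> y"
  shows "count_below E x = count_below E y \<longleftrightarrow> E \<inter> {x..<y} = {}"
  using count_below_add_card_between[OF assms] assms(1) by simp

lemma count_below_diff_mono:
  assumes "finite E'" "E \<subseteq> E'" "x \<le> y"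
  shows "count_below E y - count_below E x \<le> count_below E' y - count_below E' x"
proof -
  have "card (E \<inter> {x..<y}) \<le> card (E' \<inter> {x..<y})"
    using assms by (intro card_mono) auto
  then show ?thesis
    using count_below_add_card_between[OF finite_subset[OF assms(2,1)] assms(3)]
      count_below_add_card_between[OF assms(1,3)] by simp
qed

lemma count_below_eq_subset:
  assumes "finite E'" "E \<subseteq> E'" "count_below E' x = count_below E' y"
  shows "count_below E x = count_below E y"
proof -
  have "count_below E u = count_below E v" if "u \<le> v" "count_below E' u = count_below E' v" for u v
    using that assms(1,2) finite_subset[OF assms(2,1)] by (auto simp: count_below_eq_iff)
  then show ?thesis
    using assms(3) by (metis linear)
qed

lemma between_or_count_below_eq_if_diff_eq:
  assumes "finite E'" "E \<subseteq> E'"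
    and "count_below E' x - count_below E' y = count_below E x' - count_below E y"
  shows "x \<in> {min x' y..max x' y} \<or> count_below E x = count_below E x'"
proof (cases "y \<le> x")
  case True
  then have "count_below E x \<le> count_below E x'"
    using count_below_diff_mono[OF assms(1,2) True] assms(3) by simp
  then show ?thesis
    using True count_below_mono[OF finite_subset[OF assms(2,1)], of x' x]
    by (cases "x \<le> x'") auto
next
  case False
  then have "x \<le> y"
    by simp
  then have "count_below E x' \<le> count_below E x"
    using count_below_diff_mono[OF assms(1,2) \<open>x \<le> y\<close>] assms(3) by simp
  then show ?thesis
    using False count_below_mono[OF finite_subset[OF assms(2,1)], of x x']
    by (cases "x' \<le> x") auto
qed

section \<open>Interval \<sigma>-algebras\<close>

lemma (in semiring_of_sets) atom_subset_if_meets: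
  assumes "A \<in> atoms M" "B \<in> M" "A \<inter> B \<noteq> {}"
  shows "A \<subseteq> B"
proof -
  have "A \<inter> B \<in> M"
    using assms by (auto simp: atoms_def)
  then show ?thesis
    using assms unfolding atoms_def by blast
qed

text \<open>Counting right endpoints instead of atoms makes the growth of index differences under refinement
  an inclusion of sets.\<close>

definition endpoints :: "real set set \<Rightarrow> real set" where
  "endpoints M = Sup ` atoms M"

locale interval_algebra =
  fixes a b :: real and M :: "real set set"
  assumes interval_sigma_algebra: "interval_sigma_algebra a b M"
begin

lemma finite_atoms: "finite (atoms M)"
  and partition_on_atoms: "partition_on {a<..b} (atoms M)"
  and sigma_sets_atoms: "sigma_sets {a<..b} (atoms M) = M"
  and atom_eq_Ioc: "A \<in> atoms M \<Longrightarrow> \<exists>c c'. c < c' \<and> A = {c<..c'}"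
proof -
  obtain P where P: "finite P" "partition_on {a<..b} P" "\<forall>A\<in>P. \<exists>c c'. c < c' \<and> A = {c<..c'}"
    "M = sigma_sets {a<..b} P"
    using interval_sigma_algebra unfolding interval_sigma_algebra_def by blast
  moreover have "atoms M = P"
    using atoms_sigma_sets_partition[OF P(2)] P(4) by simp
  ultimately show "finite (atoms M)" "partition_on {a<..b} (atoms M)"
    "sigma_sets {a<..b} (atoms M) = M" "A \<in> atoms M \<Longrightarrow> \<exists>c c'. c < c' \<and> A = {c<..c'}"
    by auto
qed

lemma atom_subset_Ioc: "A \<in> atoms M \<Longrightarrow> A \<subseteq> {a<..b}"
  using partition_onD1[OF partition_on_atoms] by blast

sublocale sigma_algebra "{a<..b}" M
  using sigma_algebra_sigma_sets[of "atoms M" "{a<..b}"] atom_subset_Ioc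
  by (simp add: sigma_sets_atoms Pow_def subset_eq)

lemma ex_atom: "x \<in> {a<..b} \<Longrightarrow> \<exists>A\<in>atoms M. x \<in> A"
  using partition_onD1[OF partition_on_atoms] by blast

lemma atom_eqI:
  assumes "A \<in> atoms M" "B \<in> atoms M" "x \<in> A" "x \<in> B"
  shows "A = B"
  using partition_on_atoms assms by (auto simp: partition_on_def disjoint_def)

lemma is_interval_atom: "A \<in> atoms M \<Longrightarrow> is_interval A"
  by (drule atom_eq_Ioc) (auto simp: is_interval_oc)

lemma Sup_atom_in: "A \<in> atoms M \<Longrightarrow> Sup A \<in> A"
  by (drule atom_eq_Ioc) auto

lemma le_Sup_atom: "A \<in> atoms M \<Longrightarrow> x \<in> A \<Longrightarrow> x \<le> Sup A"
  by (drule atom_eq_Ioc) auto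

lemma inj_on_Sup_atoms: "inj_on Sup (atoms M)"
  by (rule inj_onI) (metis Sup_atom_in atom_eqI)

lemma finite_endpoints: "finite (endpoints M)"
  by (simp add: endpoints_def finite_atoms)

lemma atom_less_atom_iff:
  assumes A: "A \<in> atoms M" "x \<in> A" and B: "B \<in> atoms M"
  shows "(\<forall>u\<in>B. \<forall>v\<in>A. u < v) \<longleftrightarrow> Sup B < x"
proof
  assume "\<forall>u\<in>B. \<forall>v\<in>A. u < v"
  then show "Sup B < x"
    using Sup_atom_in[OF B] A(2) by blast
next
  assume "Sup B < x"
  then have "Sup B \<notin> A"
    using atom_eqI[OF A(1) B _ Sup_atom_in[OF B]] le_Sup_atom[OF A] by force
  show "\<forall>u\<in>B. \<forall>v\<in>A. u < v"
  proof (intro ballI, rule ccontr)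
    fix u v
    assume "u \<in> B" "v \<in> A" "\<not> u < v"
    then have "v \<le> Sup B"
      using le_Sup_atom[OF B, of u] by simp
    then have "Sup B \<in> A"
      using mem_is_interval_1_I[OF is_interval_atom[OF A(1)] \<open>v \<in> A\<close> A(2)] \<open>Sup B < x\<close> by simp
    then show False
      using \<open>Sup B \<notin> A\<close> by contradiction
  qed
qed

lemma atom_index_eq_count_below:
  assumes "A \<in> atoms M" "x \<in> A"
  shows "atom_index M A = count_below (endpoints M) x"
proof -
  have "{B \<in> atoms M. \<forall>u\<in>B. \<forall>v\<in>A. u < v} = {B \<in> atoms M. Sup B < x}"
    using atom_less_atom_iff[OF assms] by blast
  moreover have "{e \<in> endpoints M. e < x} = Sup ` {B \<in> atoms M. Sup B < x}"
    unfolding endpoints_def by blast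
  moreover have "inj_on Sup {B \<in> atoms M. Sup B < x}"
    using inj_on_Sup_atoms by (rule inj_on_subset) blast
  ultimately show ?thesis
    by (simp add: atom_index_def count_below_def card_image)
qed

lemma mem_atom_iff_count_below_eq_of_le:
  assumes A: "A \<in> atoms M" "x \<in> A" and "x \<le> y"
  shows "y \<in> A \<longleftrightarrow> count_below (endpoints M) x = count_below (endpoints M) y"
  unfolding count_below_eq_iff[OF finite_endpoints \<open>x \<le> y\<close>]
proof
  assume "y \<in> A"
  show "endpoints M \<inter> {x..<y} = {}"
  proof (rule ccontr)
    assume "endpoints M \<inter> {x..<y} \<noteq> {}"
    then obtain B where B: "B \<in> atoms M" "x \<le> Sup B" "Sup B < y"
      by (auto simp: endpoints_def)
    then have "Sup B \<in> A"
      using mem_is_interval_1_I[OF is_interval_atom[OF A(1)] A(2) \<open>y \<in> A\<close>] by simp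
    then have "A = B"
      using atom_eqI[OF A(1) B(1)] Sup_atom_in[OF B(1)] by blast
    then show False
      using le_Sup_atom[OF A(1) \<open>y \<in> A\<close>] B(3) by simp
  qed
next
  assume "endpoints M \<inter> {x..<y} = {}"
  then have "Sup A \<notin> {x..<y}"
    using A(1) by (auto simp: endpoints_def)
  then have "y \<le> Sup A"
    using le_Sup_atom[OF A] by simp
  then show "y \<in> A"
    using mem_is_interval_1_I[OF is_interval_atom[OF A(1)] A(2) Sup_atom_in[OF A(1)]] \<open>x \<le> y\<close> by simp
qed

lemma mem_atom_iff_count_below_eq:
  assumes A: "A \<in> atoms M" "x \<in> A"
  shows "y \<in> A \<longleftrightarrow> y \<in> {a<..b} \<and> count_below (endpoints M) y = count_below (endpoints M) x"
proof (cases "y \<in> {a<..b}")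
  case True
  then obtain B where B: "B \<in> atoms M" "y \<in> B"
    using ex_atom by blast
  have "y \<in> A \<longleftrightarrow> x \<in> B"
    using atom_eqI[OF A(1) B(1)] A(2) B(2) by blast
  then show ?thesis
    using True mem_atom_iff_count_below_eq_of_le[OF A, of y]
      mem_atom_iff_count_below_eq_of_le[OF B, of x] by (cases "x \<le> y") auto
qed (use atom_subset_Ioc[OF A(1)] in blast)

end

lemma endpoints_mono:
  assumes "interval_algebra a b M" "interval_algebra a b N" "M \<subseteq> N"
  shows "endpoints M \<subseteq> endpoints N"
proof
  interpret M: interval_algebra a b M by fact
  interpret N: interval_algebra a b N by fact
  fix e
  assume "e \<in> endpoints M"
  then obtain A where A: "A \<in> atoms M" "e = Sup A"
    by (auto simp: endpoints_def)
  then have "e \<in> A" "A \<in> N"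
    using M.Sup_atom_in \<open>M \<subseteq> N\<close> by (auto simp: atoms_def)
  then obtain B where B: "B \<in> atoms N" "e \<in> B"
    using N.ex_atom M.atom_subset_Ioc[OF A(1)] by blast
  then have "B \<subseteq> A"
    using N.atom_subset_if_meets[OF B(1) \<open>A \<in> N\<close>] \<open>e \<in> A\<close> by blast
  then have "Sup B \<le> e"
    using M.le_Sup_atom[OF A(1)] N.Sup_atom_in[OF B(1)] A(2) by blast
  moreover have "e \<le> Sup B"
    by (rule N.le_Sup_atom[OF B])
  ultimately show "e \<in> endpoints N"
    using B(1) by (auto simp: endpoints_def)
qed

section \<open>Rectangles\<close>

lemma mem_cube_iff: "x \<in> cube a b \<longleftrightarrow> (\<forall>l. x $ l \<in> {a<..b})"
  by (simp add: cube_def cart_box_def)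

lemma image_nth_cart_box:
  assumes "x \<in> cart_box J"
  shows "(\<lambda>y. y $ l) ` cart_box J = J l"
proof (intro equalityI subsetI)
  fix u
  assume "u \<in> J l"
  then have "(\<chi> i. if i = l then u else x $ i) \<in> cart_box J"
    using assms by (simp add: cart_box_def)
  then show "u \<in> (\<lambda>y. y $ l) ` cart_box J"
    by (rule rev_image_eqI) simp
qed (auto simp: cart_box_def)

lemma rectangle_cart_box: "(\<And>l. is_interval (J l)) \<Longrightarrow> rectangle (cart_box J)"
  by (auto simp: rectangle_def)

lemma rectangle_cube: "rectangle (cube a b)"
  unfolding cube_def by (rule rectangle_cart_box) (rule is_interval_oc)

lemma convex_rectangle: "rectangle R \<Longrightarrow> convex R"
  unfolding rectangle_def cart_box_def convex_alt is_interval_convex_1 by fastforce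

lemma bounded_cube: "bounded (cube a b :: (real^'n::finite) set)"
proof (rule bounded_subset)
  show "(cube a b :: (real^'n) set) \<subseteq> cbox (\<chi> _. a) (\<chi> _. b)"
    by (auto simp: mem_cube_iff mem_box_cart less_imp_le)
qed simp

lemma lmeasurable_rectangle:
  fixes R :: "(real^'n::finite) set"
  assumes "rectangle R" "R \<subseteq> cube a b"
  shows "R \<in> lmeasurable"
  using convex_rectangle[OF assms(1)] bounded_subset[OF bounded_cube assms(2)]
  by (rule measurable_convex)

definition coordinate_span :: "(real^'n) set \<Rightarrow> 'n \<Rightarrow> real set" where
  "coordinate_span S l = {t. \<exists>u\<in>S. \<exists>v\<in>S. u $ l \<le> t \<and> t \<le> v $ l}"

lemma is_interval_coordinate_span: "is_interval (coordinate_span S l)"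
  unfolding is_interval_1 coordinate_span_def by (blast intro: order_trans)

lemma re_eq_cart_box: "re S = cart_box (coordinate_span S)"
  unfolding re_def
proof (rule hull_unique)
  show "S \<subseteq> cart_box (coordinate_span S)"
    by (auto simp: cart_box_def coordinate_span_def)
  show "rectangle (cart_box (coordinate_span S))"
    by (intro rectangle_cart_box is_interval_coordinate_span)
  fix R
  assume "S \<subseteq> R" "rectangle R"
  then obtain J where J: "R = cart_box J" "\<And>l. is_interval (J l)"
    by (auto simp: rectangle_def)
  have "coordinate_span S l \<subseteq> J l" for l
  proof
    fix t
    assume "t \<in> coordinate_span S l"
    then obtain u v where "u \<in> S" "v \<in> S" "u $ l \<le> t" "t \<le> v $ l"
      by (auto simp: coordinate_span_def)
    moreover from this have "u $ l \<in> J l" "v $ l \<in> J l"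
      using \<open>S \<subseteq> R\<close> by (auto simp: J(1) cart_box_def)
    ultimately show "t \<in> J l"
      using mem_is_interval_1_I[OF J(2)] by blast
  qed
  then show "cart_box (coordinate_span S) \<subseteq> R"
    by (auto simp: J(1) cart_box_def)
qed

lemma lmeasurable_re:
  fixes S :: "(real^'n::finite) set"
  assumes "S \<subseteq> cube a b"
  shows "re S \<in> lmeasurable"
proof (rule lmeasurable_rectangle)
  show "rectangle (re S)"
    unfolding re_eq_cart_box by (intro rectangle_cart_box is_interval_coordinate_span)
  show "re S \<subseteq> cube a b"
    unfolding re_def using assms rectangle_cube by (rule hull_minimal)
qed

section \<open>Products of interval \<sigma>-algebras and their refinements\<close>

abbreviation cells :: "real \<Rightarrow> real \<Rightarrow> ('n \<Rightarrow> real set set) \<Rightarrow> (real^'n) set set" where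
  "cells a b M \<equiv> atoms (prod_sigma_algebra a b M)"

definition position :: "('n \<Rightarrow> real set set) \<Rightarrow> real^'n \<Rightarrow> 'n \<Rightarrow> int" where
  "position M x l = count_below (endpoints (M l)) (x $ l)"

definition offset :: "('n \<Rightarrow> real set set) \<Rightarrow> (real^'n) set \<Rightarrow> (real^'n) set \<Rightarrow> 'n \<Rightarrow> int" where
  "offset M A B l = multi_index M A l - multi_index M B l"

locale interval_algebra_product =
  fixes a b :: real and M :: "'n::finite \<Rightarrow> real set set"
  assumes interval_sigma_algebra_factor: "interval_sigma_algebra a b (M l)"
begin

sublocale factor: interval_algebra a b "M l" for l
  by unfold_locales (rule interval_sigma_algebra_factor)

lemmas cells_eq = atoms_prod_sigma_algebra[of a b M, OF interval_sigma_algebra_factor]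

lemma cell_nonempty: "A \<in> cells a b M \<Longrightarrow> A \<noteq> {}"
  by (simp add: atoms_def)

lemma multi_index_eq_position:
  assumes "A \<in> cells a b M" "x \<in> A"
  shows "multi_index M A = position M x"
proof
  fix l
  obtain J where J: "A = cart_box J" "\<And>l. J l \<in> atoms (M l)"
    using assms(1) unfolding cells_eq by blast
  then have "(\<lambda>y. y $ l) ` A = J l"
    using image_nth_cart_box[of x J l] assms(2) by simp
  moreover have "x $ l \<in> J l"
    using assms(2) by (simp add: J(1) cart_box_def)
  ultimately show "multi_index M A l = position M x l"
    using factor.atom_index_eq_count_below[OF J(2)] by (simp add: multi_index_def position_def)
qed

lemma mem_cell_iff_position_eq:
  assumes "A \<in> cells a b M" "x \<in> A"
  shows "y \<in> A \<longleftrightarrow> y \<in> cube a b \<and> position M y = position M x"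
proof -
  obtain J where J: "A = cart_box J" "\<And>l. J l \<in> atoms (M l)"
    using assms(1) unfolding cells_eq by blast
  have "y $ l \<in> J l \<longleftrightarrow> y $ l \<in> {a<..b} \<and> position M y l = position M x l" for l
    unfolding position_def
    by (rule factor.mem_atom_iff_count_below_eq[OF J(2)]) (use assms(2) J(1) in \<open>simp add: cart_box_def\<close>)
  then show ?thesis
    unfolding J(1) cart_box_def mem_cube_iff fun_eq_iff by blast
qed

lemma cell_subset_cube: "A \<in> cells a b M \<Longrightarrow> A \<subseteq> cube a b"
  using mem_cell_iff_position_eq by blast

lemma cell_eqI:
  assumes "A \<in> cells a b M" "B \<in> cells a b M" "x \<in> A" "x \<in> B"
  shows "A = B"
  using mem_cell_iff_position_eq[OF assms(1,3)] mem_cell_iff_position_eq[OF assms(2,4)] by blast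

lemma ex_cell:
  assumes "x \<in> cube a b"
  shows "\<exists>A\<in>cells a b M. x \<in> A"
proof -
  have "\<forall>l. \<exists>A. A \<in> atoms (M l) \<and> x $ l \<in> A"
    using factor.ex_atom assms unfolding mem_cube_iff by blast
  then obtain J where J: "\<And>l. J l \<in> atoms (M l) \<and> x $ l \<in> J l"
    by metis
  then have "cart_box J \<in> cells a b M" "x \<in> cart_box J"
    unfolding cells_eq by (auto simp: cart_box_def)
  then show ?thesis
    by blast
qed

lemma atom_at_eq: "A \<in> cells a b M \<Longrightarrow> x \<in> A \<Longrightarrow> atom_at (prod_sigma_algebra a b M) x = A"
  unfolding atom_at_def by (rule the_equality) (use cell_eqI in blast)+

lemma cube_and_atom_at_iff:
  "x \<in> cube a b \<and> P (atom_at (prod_sigma_algebra a b M) x) \<longleftrightarrow> (\<exists>A\<in>cells a b M. x \<in> A \<and> P A)"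
  using ex_cell[of x] cell_subset_cube atom_at_eq[of _ x] by fastforce

lemma finite_cells: "finite (cells a b M)"
proof -
  have "cells a b M = cart_box ` (\<Pi>\<^sub>E l\<in>UNIV. atoms (M l))"
    unfolding cells_eq
    by (auto simp: PiE_UNIV_domain)
  then show ?thesis
    by (simp add: finite_PiE factor.finite_atoms)
qed

lemma lmeasurable_cell:
  assumes "A \<in> cells a b M"
  shows "A \<in> lmeasurable"
proof (rule lmeasurable_rectangle)
  show "rectangle A"
    using assms rectangle_cart_box factor.is_interval_atom unfolding cells_eq by blast
  show "A \<subseteq> cube a b"
    by (rule cell_subset_cube[OF assms])
qed

lemma inj_on_multi_index: "inj_on (multi_index M) (cells a b M)"
proof (rule inj_onI)
  fix A B
  assume A: "A \<in> cells a b M" and B: "B \<in> cells a b M" and eq: "multi_index M A = multi_index M B"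
  then obtain x y where "x \<in> A" "y \<in> B"
    using cell_nonempty by blast
  moreover from this have "position M x = position M y"
    using eq multi_index_eq_position[OF A] multi_index_eq_position[OF B] by simp
  ultimately have "x \<in> B"
    using mem_cell_iff_position_eq[OF B] cell_subset_cube[OF A] by blast
  then show "A = B"
    using cell_eqI[OF A B \<open>x \<in> A\<close>] by simp
qed

end

locale interval_algebra_refinement =
  coarse: interval_algebra_product a b M + fine: interval_algebra_product a b N
  for a b :: real and M N :: "'n::finite \<Rightarrow> real set set" +
  assumes refines: "M l \<subseteq> N l"
begin

lemma endpoints_factor_mono: "endpoints (M l) \<subseteq> endpoints (N l)"
  by (rule endpoints_mono[OF _ _ refines]) unfold_locales

lemma cells_nested:
  assumes A: "A \<in> cells a b N" and B: "B \<in> cells a b M"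
  shows "A \<subseteq> B \<or> A \<inter> B = {}"
proof (rule disjCI)
  assume "A \<inter> B \<noteq> {}"
  then obtain x where x: "x \<in> A" "x \<in> B"
    by blast
  show "A \<subseteq> B"
  proof
    fix y
    assume "y \<in> A"
    then have "y \<in> cube a b" "position N y = position N x"
      using fine.mem_cell_iff_position_eq[OF A x(1)] by auto
    then show "y \<in> B"
      unfolding coarse.mem_cell_iff_position_eq[OF B x(2)] position_def fun_eq_iff
      using count_below_eq_subset[OF fine.factor.finite_endpoints endpoints_factor_mono] by blast
  qed
qed

lemma cell_subset_re_if_offset_eq:
  assumes A: "A \<in> cells a b M" and B: "B \<in> cells a b M"
    and A': "A' \<in> cells a b N" and B': "B' \<in> cells a b N"
    and offset_eq: "offset N B' A' = offset M B A" and "B' \<subseteq> B"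
  shows "A' \<subseteq> re (B \<union> A)"
proof
  fix x
  assume x: "x \<in> A'"
  obtain y z where y: "y \<in> B'" "y \<in> B" and z: "z \<in> A"
    using coarse.cell_nonempty[OF A] fine.cell_nonempty[OF B'] \<open>B' \<subseteq> B\<close> by blast
  have "x $ l \<in> coordinate_span (B \<union> A) l" for l
  proof -
    have "offset N B' A' l = offset M B A l"
      by (simp add: offset_eq)
    then have "position N x l - position N y l = position M z l - position M y l"
      by (simp add: offset_def
          coarse.multi_index_eq_position[OF A z] coarse.multi_index_eq_position[OF B y(2)]
          fine.multi_index_eq_position[OF A' x] fine.multi_index_eq_position[OF B' y(1)])
    then consider (between) "x $ l \<in> {min (z $ l) (y $ l)..max (z $ l) (y $ l)}"
      | (same_slab) "position M x l = position M z l"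
      using between_or_count_below_eq_if_diff_eq[OF fine.factor.finite_endpoints endpoints_factor_mono]
      unfolding position_def by blast
    then show ?thesis
    proof cases
      case between
      then show ?thesis
        using y(2) z by (auto simp: coordinate_span_def min_def max_def split: if_splits)
    next
      case same_slab
      define u :: "real^'n" where "u = (\<chi> i. if i = l then x $ l else z $ i)"
      have "u \<in> A"
        using same_slab fine.cell_subset_cube[OF A'] coarse.cell_subset_cube[OF A] x z
        by (auto simp: coarse.mem_cell_iff_position_eq[OF A z] u_def mem_cube_iff position_def fun_eq_iff)
      then show ?thesis
        by (auto simp: coordinate_span_def u_def intro!: bexI[of _ u])
    qed
  qed
  then show "x \<in> re (B \<union> A)"
    by (simp add: re_eq_cart_box cart_box_def)
qed

end

section \<open>A covering estimate for nested families\<close>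

lemma nested_family_disjoint_subcover:
  fixes \<tau> :: "'i \<Rightarrow> 't::linorder" and B :: "'i \<Rightarrow> 'a set"
  assumes "finite I"
    and "\<And>i j. i \<in> I \<Longrightarrow> j \<in> I \<Longrightarrow> \<tau> i \<le> \<tau> j \<Longrightarrow> B j \<subseteq> B i \<or> B j \<inter> B i = {}"
  shows "\<exists>U\<subseteq>I. disjoint_family_on B U \<and> (\<forall>j\<in>I. \<exists>i\<in>U. \<tau> i \<le> \<tau> j \<and> B j \<subseteq> B i)"
  using assms
proof (induction I rule: finite_ranking_induct[where f = \<tau>])
  case (insert j I)
  then obtain U where U: "U \<subseteq> I" "disjoint_family_on B U" "\<forall>j\<in>I. \<exists>i\<in>U. \<tau> i \<le> \<tau> j \<and> B j \<subseteq> B i"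
    by blast
  have le: "\<tau> i \<le> \<tau> j" if "i \<in> U" for i
    using insert.hyps(2) U(1) that by blast
  show ?case
  proof (cases "\<exists>i\<in>U. B j \<subseteq> B i")
    case True
    then show ?thesis
      using U le by (intro exI[of _ U]) auto
  next
    case False
    then have "B j \<inter> B i = {}" if "i \<in> U" for i
      using insert.prems[of i j] le[OF that] U(1) that by blast
    then have "disjoint_family_on B (insert j U)"
      using U(2) by (auto simp: disjoint_family_on_def)
    moreover have "\<forall>i\<in>insert j I. \<exists>u\<in>insert j U. \<tau> u \<le> \<tau> i \<and> B i \<subseteq> B u"
      using U(3) by auto
    ultimately show ?thesis
      using U(1) by (intro exI[of _ "insert j U"]) auto
  qed
qed (simp add: disjoint_family_on_def)

lemma sum_set_integral_disjoint_le:
  fixes g :: "'a \<Rightarrow> real"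
  assumes "finite U" "disjoint_family_on B U" "\<And>i. i \<in> U \<Longrightarrow> B i \<in> sets M" "\<And>i. i \<in> U \<Longrightarrow> B i \<subseteq> \<Omega>"
    and g: "set_integrable M \<Omega> g" "\<And>x. 0 \<le> g x"
  shows "(\<Sum>i\<in>U. LINT x:B i|M. g x) \<le> (LINT x:\<Omega>|M. g x)"
proof -
  have "(\<Sum>i\<in>U. LINT x:B i|M. g x) = (LINT x:(\<Union>i\<in>U. B i)|M. g x)"
    using assms by (intro set_integral_finite_Union[symmetric]) (auto intro: set_integrable_subset)
  also have "\<dots> \<le> (LINT x:\<Omega>|M. g x)"
    using g assms(4) unfolding set_lebesgue_integral_def set_integrable_def
    by (intro integral_mono') (auto simp: indicator_def)
  finally show ?thesis .
qed

lemma measure_UN_le_of_nested_family: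
  fixes \<tau> :: "'i \<Rightarrow> 't::linorder" and g :: "'a \<Rightarrow> real"
  assumes "finite I" "0 \<le> w" and g: "set_integrable M \<Omega> g" "\<And>x. 0 \<le> g x"
    and A: "\<And>i. i \<in> I \<Longrightarrow> A i \<in> sets M"
    and B: "\<And>i. i \<in> I \<Longrightarrow> B i \<in> sets M" "\<And>i. i \<in> I \<Longrightarrow> B i \<subseteq> \<Omega>"
    and R: "\<And>i. i \<in> I \<Longrightarrow> R i \<in> fmeasurable M"
    and measure_R: "\<And>i. i \<in> I \<Longrightarrow> measure M (R i) \<le> w * (LINT x:B i|M. g x)"
    and nested: "\<And>i j. i \<in> I \<Longrightarrow> j \<in> I \<Longrightarrow> \<tau> i \<le> \<tau> j \<Longrightarrow> B j \<subseteq> B i \<or> B j \<inter> B i = {}"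
    and absorb: "\<And>i j. i \<in> I \<Longrightarrow> j \<in> I \<Longrightarrow> \<tau> i \<le> \<tau> j \<Longrightarrow> B j \<subseteq> B i \<Longrightarrow> A j \<subseteq> R i"
  shows "measure M (\<Union>i\<in>I. A i) \<le> w * (LINT x:\<Omega>|M. g x)"
proof -
  obtain U where U: "U \<subseteq> I" "disjoint_family_on B U" "\<forall>j\<in>I. \<exists>i\<in>U. \<tau> i \<le> \<tau> j \<and> B j \<subseteq> B i"
    using nested_family_disjoint_subcover[of I \<tau> B, OF \<open>finite I\<close> nested] by auto
  have "finite U"
    by (rule finite_subset[OF U(1) \<open>finite I\<close>])
  have cover: "(\<Union>i\<in>I. A i) \<subseteq> (\<Union>i\<in>U. R i)"
    using U(1,3) absorb by blast
  have "measure M (\<Union>i\<in>I. A i) \<le> measure M (\<Union>i\<in>U. R i)"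
  proof (rule measure_mono_fmeasurable[OF cover])
    show "(\<Union>i\<in>I. A i) \<in> sets M"
      using \<open>finite I\<close> A by (intro sets.finite_UN)
    show "(\<Union>i\<in>U. R i) \<in> fmeasurable M"
      using \<open>finite U\<close> U(1) R by (intro fmeasurable.finite_UN) auto
  qed
  also have "\<dots> \<le> (\<Sum>i\<in>U. measure M (R i))"
    using \<open>finite U\<close> U(1) R by (intro measure_UNION_le) auto
  also have "\<dots> \<le> (\<Sum>i\<in>U. w * (LINT x:B i|M. g x))"
    using U(1) measure_R by (intro sum_mono) blast
  also have "\<dots> = w * (\<Sum>i\<in>U. LINT x:B i|M. g x)"
    by (simp add: sum_distrib_left)
  also have "\<dots> \<le> w * (LINT x:\<Omega>|M. g x)"
    using \<open>finite U\<close> U(1,2) B g \<open>0 \<le> w\<close> by (intro mult_left_mono sum_set_integral_disjoint_le) auto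
  finally show ?thesis .
qed

section \<open>Geometric sums over integer vectors\<close>

definition l1_norm :: "('n::finite \<Rightarrow> int) \<Rightarrow> nat" where
  "l1_norm k = (\<Sum>l\<in>UNIV. nat \<bar>k l\<bar>)"

lemma sum_power_le_geometric:
  fixes r :: real
  assumes "0 \<le> r" "r < 1" "finite I" "inj_on h I"
  shows "(\<Sum>i\<in>I. r ^ h i) \<le> 1 / (1 - r)"
proof -
  have "(\<Sum>i\<in>I. r ^ h i) = (\<Sum>n\<in>h ` I. r ^ n)"
    using assms(4) by (simp add: sum.reindex)
  also have "\<dots> \<le> (\<Sum>n. r ^ n)"
    using assms by (intro sum_le_suminf summable_geometric) auto
  also have "\<dots> = 1 / (1 - r)"
    using assms by (intro suminf_geometric) auto
  finally show ?thesis .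
qed

lemma sum_power_nat_abs_le:
  fixes r :: real and I :: "int set"
  assumes "0 \<le> r" "r < 1" "finite I"
  shows "(\<Sum>i\<in>I. r ^ nat \<bar>i\<bar>) \<le> 2 / (1 - r)"
proof -
  have "(\<Sum>i\<in>I. r ^ nat \<bar>i\<bar>) = (\<Sum>i\<in>I \<inter> {0..}. r ^ nat \<bar>i\<bar>) + (\<Sum>i\<in>I - {0..}. r ^ nat \<bar>i\<bar>)"
    using assms(3) by (rule sum.Int_Diff)
  also have "\<dots> \<le> 1 / (1 - r) + 1 / (1 - r)"
    using assms by (intro add_mono sum_power_le_geometric) (auto simp: inj_on_def)
  finally show ?thesis
    by simp
qed

definition lattice_sum_bound :: "real \<Rightarrow> nat \<Rightarrow> real" where
  "lattice_sum_bound r d = (2 / (1 - r)) ^ d"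

lemma lattice_sum_bound_pos: "r < 1 \<Longrightarrow> 0 < lattice_sum_bound r d"
  by (simp add: lattice_sum_bound_def)

lemma sum_power_l1_norm_le:
  fixes r :: real and K :: "('n::finite \<Rightarrow> int) set"
  assumes "0 \<le> r" "r < 1" "finite K"
  shows "(\<Sum>k\<in>K. r ^ l1_norm k) \<le> lattice_sum_bound r CARD('n)"
proof -
  define I where "I l = (\<lambda>k. k l) ` K" for l
  have "finite (I l)" for l
    using assms(3) by (simp add: I_def)
  have "(\<Sum>k\<in>K. r ^ l1_norm k) \<le> (\<Sum>k\<in>Pi\<^sub>E UNIV I. r ^ l1_norm k)"
    using assms(1) \<open>\<And>l. finite (I l)\<close> by (intro sum_mono2 finite_PiE) (auto simp: I_def)
  also have "\<dots> = (\<Prod>l\<in>UNIV. \<Sum>i\<in>I l. r ^ nat \<bar>i\<bar>)"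
    using \<open>\<And>l. finite (I l)\<close> by (simp add: prod_sum_PiE l1_norm_def power_sum)
  also have "\<dots> \<le> (\<Prod>l\<in>(UNIV::'n set). 2 / (1 - r))"
    using assms(1,2) \<open>\<And>l. finite (I l)\<close> by (intro prod_mono conjI sum_nonneg sum_power_nat_abs_le) auto
  finally show ?thesis
    by (simp add: lattice_sum_bound_def)
qed

section \<open>The weak type estimate\<close>

lemma atom_dist_eq_l1_norm_offset: "atom_dist M A B = l1_norm (offset M A B)"
  by (simp add: atom_dist_def l1_norm_def offset_def nat_eq_iff sum_nonneg)

definition weighted_avg ::
  "real \<Rightarrow> real \<Rightarrow> real \<Rightarrow> ('n::finite \<Rightarrow> real set set) \<Rightarrow> (real^'n \<Rightarrow> real) \<Rightarrow> (real^'n) set \<Rightarrow> real" where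
  "weighted_avg q a b M f A = (\<Sum>B\<in>cells a b M.
     q ^ atom_dist M B A / measure lebesgue (re (B \<union> A)) * (LINT y:B|lebesgue. \<bar>f y\<bar>))"

lemma exists_gt_proportional_share:
  fixes g w :: "'a \<Rightarrow> real"
  assumes "(\<Sum>i\<in>I. w i) \<le> S" "0 < S" "0 \<le> t" "t < (\<Sum>i\<in>I. g i)"
  shows "\<exists>i\<in>I. t / S * w i < g i"
proof (rule ccontr)
  assume "\<not> ?thesis"
  then have "(\<Sum>i\<in>I. g i) \<le> (\<Sum>i\<in>I. t / S * w i)"
    by (intro sum_mono) (simp add: not_less)
  also have "\<dots> = t / S * (\<Sum>i\<in>I. w i)"
    by (simp add: sum_distrib_left)
  also have "\<dots> \<le> t / S * S"
    using assms(1-3) by (intro mult_left_mono) auto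
  finally show False
    using assms(2,4) by simp
qed

context interval_algebra_product
begin

lemma sum_power_atom_dist_le:
  fixes r :: real
  assumes "0 \<le> r" "r < 1"
  shows "(\<Sum>B\<in>cells a b M. r ^ atom_dist M B A) \<le> lattice_sum_bound r CARD('n)"
proof -
  have "inj_on (\<lambda>B. offset M B A) (cells a b M)"
    using inj_on_multi_index by (simp add: inj_on_def offset_def fun_eq_iff)
  then have "(\<Sum>B\<in>cells a b M. r ^ atom_dist M B A)
      = (\<Sum>k\<in>(\<lambda>B. offset M B A) ` cells a b M. r ^ l1_norm k)"
    by (simp add: sum.reindex atom_dist_eq_l1_norm_offset)
  also have "\<dots> \<le> lattice_sum_bound r CARD('n)"
    using assms finite_cells by (intro sum_power_l1_norm_le) auto
  finally show ?thesis .
qed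

lemma ex_heavy_cell_if_weighted_avg_gt:
  assumes "0 \<le> r" "r < 1" "0 < t" "t < weighted_avg (r\<^sup>2) a b M f A"
  shows "\<exists>B\<in>cells a b M. measure lebesgue (re (B \<union> A))
    \<le> lattice_sum_bound r CARD('n) / t * r ^ atom_dist M B A * (LINT y:B|lebesgue. \<bar>f y\<bar>)"
proof -
  define S where "S = lattice_sum_bound r CARD('n)"
  have "0 < S"
    unfolding S_def by (rule lattice_sum_bound_pos[OF assms(2)])
  then obtain B where B: "B \<in> cells a b M" "t / S * r ^ atom_dist M B A
      < (r\<^sup>2) ^ atom_dist M B A / measure lebesgue (re (B \<union> A)) * (LINT y:B|lebesgue. \<bar>f y\<bar>)"
    using exists_gt_proportional_share[OF sum_power_atom_dist_le[OF assms(1,2), of A, folded S_def]]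
      assms(3,4)
    unfolding weighted_avg_def by (meson less_imp_le)
  define \<rho> \<mu> m where "\<rho> = r ^ atom_dist M B A" and "\<mu> = measure lebesgue (re (B \<union> A))"
    and "m = (LINT y:B|lebesgue. \<bar>f y\<bar>)"
  have less: "t / S * \<rho> < \<rho> * \<rho> / \<mu> * m"
    using B(2) by (simp add: \<rho>_def \<mu>_def m_def power2_eq_square power_mult_distrib)
  have "0 \<le> \<rho>" "0 \<le> \<mu>"
    using assms(1) by (simp_all add: \<rho>_def \<mu>_def)
  then have "0 \<le> t / S * \<rho>"
    using \<open>0 < S\<close> \<open>0 < t\<close> by simp
  then have "\<rho> * \<rho> / \<mu> * m \<noteq> 0"
    using less by linarith
  then have "0 < \<rho>" "0 < \<mu>"  \<comment> \<open>as \<open>x / 0 = 0\<close>\<close>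
    using \<open>0 \<le> \<rho>\<close> \<open>0 \<le> \<mu>\<close> by (auto simp: less_le)
  then have "\<mu> \<le> S / t * \<rho> * m"
    using less \<open>0 < S\<close> \<open>0 < t\<close> by (simp add: field_simps)
  then show ?thesis
    using B(1) unfolding S_def \<rho>_def \<mu>_def m_def by blast
qed

end

locale integrable_on_filtered_cube =
  fixes a b :: real and F :: "nat \<Rightarrow> 'n::finite \<Rightarrow> real set set" and f :: "real^'n \<Rightarrow> real"
  assumes filtration: "interval_filtration a b F"
    and integrable: "set_integrable lebesgue (cube a b) f"
begin

abbreviation cells_at :: "nat \<Rightarrow> (real^'n) set set" where
  "cells_at n \<equiv> cells a b (F n)"

abbreviation mass :: "(real^'n) set \<Rightarrow> real" where
  "mass B \<equiv> (LINT y:B|lebesgue. \<bar>f y\<bar>)"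

lemma mass_nonneg: "0 \<le> mass B"
  unfolding set_lebesgue_integral_def by (intro integral_nonneg_AE) auto

lemma algebra_at: "1 \<le> n \<Longrightarrow> interval_algebra_product a b (F n)"
  using filtration by unfold_locales (simp add: interval_filtration_def)

lemma refinement_at: "1 \<le> m \<Longrightarrow> m \<le> n \<Longrightarrow> interval_algebra_refinement a b (F m) (F n)"
  using filtration
  by (intro interval_algebra_refinement.intro interval_algebra_refinement_axioms.intro algebra_at)
    (simp_all add: interval_filtration_def)

definition heavy_pairs :: "real \<Rightarrow> ('n \<Rightarrow> int) \<Rightarrow> nat \<Rightarrow> (nat \<times> (real^'n) set \<times> (real^'n) set) set" where
  "heavy_pairs w k N = {(n, A, B). n \<in> {1..N} \<and> A \<in> cells_at n \<and> B \<in> cells_at n \<and>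
     offset (F n) B A = k \<and> measure lebesgue (re (B \<union> A)) \<le> w * mass B}"

definition heavy_set :: "real \<Rightarrow> ('n \<Rightarrow> int) \<Rightarrow> nat \<Rightarrow> (real^'n) set" where
  "heavy_set w k N = (\<Union>(n, A, B)\<in>heavy_pairs w k N. A)"

definition superlevel :: "real \<Rightarrow> real \<Rightarrow> nat \<Rightarrow> (real^'n) set" where
  "superlevel q t N = (\<Union>n\<in>{1..N}. \<Union>{A \<in> cells_at n. t < weighted_avg q a b (F n) f A})"

lemma finite_pairs_of_cells: "finite (SIGMA n:{1..N}. cells_at n \<times> cells_at n)"
  using interval_algebra_product.finite_cells[OF algebra_at] by (intro finite_SigmaI) auto

lemma finite_heavy_pairs: "finite (heavy_pairs w k N)"
  by (rule finite_subset[OF _ finite_pairs_of_cells]) (auto simp: heavy_pairs_def)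

lemma lmeasurable_heavy_set: "heavy_set w k N \<in> lmeasurable"
  unfolding heavy_set_def using finite_heavy_pairs
  by (rule fmeasurable.finite_UN)
    (auto simp: heavy_pairs_def intro: interval_algebra_product.lmeasurable_cell[OF algebra_at])

lemma lmeasurable_superlevel: "superlevel q t N \<in> lmeasurable"
  unfolding superlevel_def
  using interval_algebra_product.finite_cells[OF algebra_at]
    interval_algebra_product.lmeasurable_cell[OF algebra_at]
  by (intro fmeasurable.finite_UN fmeasurable.finite_Union) auto

lemma measure_heavy_set_le:
  assumes "0 \<le> w"
  shows "measure lebesgue (heavy_set w k N) \<le> w * mass (cube a b)"
proof -
  let ?A = "\<lambda>(n, A, B). A" and ?B = "\<lambda>(n, A, B). B" and ?R = "\<lambda>(n, A, B). re (B \<union> A)"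
  show ?thesis
    unfolding heavy_set_def
  proof (rule measure_UN_le_of_nested_family[where B = ?B and R = ?R and \<tau> = fst])
    show "finite (heavy_pairs w k N)"
      by (rule finite_heavy_pairs)
    show "set_integrable lebesgue (cube a b) (\<lambda>y. \<bar>f y\<bar>)"
      using integrable by (rule set_integrable_abs)
    fix p
    assume "p \<in> heavy_pairs w k N"
    then obtain n A B where p: "p = (n, A, B)" and "1 \<le> n"
      and A: "A \<in> cells_at n" and B: "B \<in> cells_at n"
      and offset: "offset (F n) B A = k" and "measure lebesgue (re (B \<union> A)) \<le> w * mass B"
      by (auto simp: heavy_pairs_def)
    then show "measure lebesgue (?R p) \<le> w * mass (?B p)"
      by simp
    interpret interval_algebra_product a b "F n"
      using \<open>1 \<le> n\<close> by (rule algebra_at)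
    show "?A p \<in> sets lebesgue" "?B p \<in> sets lebesgue"
      using lmeasurable_cell[OF A] lmeasurable_cell[OF B] p by auto
    show "?B p \<subseteq> cube a b" "?R p \<in> lmeasurable"
      using cell_subset_cube[OF A] cell_subset_cube[OF B] p by (auto intro: lmeasurable_re)
    fix p'
    assume "p' \<in> heavy_pairs w k N" and "fst p \<le> fst p'"
    then obtain n' A' B' where p': "p' = (n', A', B')" and "n \<le> n'" and A': "A' \<in> cells_at n'"
      and B': "B' \<in> cells_at n'" and offset': "offset (F n') B' A' = k"
      using p by (auto simp: heavy_pairs_def)
    interpret interval_algebra_refinement a b "F n" "F n'"
      using \<open>1 \<le> n\<close> \<open>n \<le> n'\<close> by (rule refinement_at)
    show "?B p' \<subseteq> ?B p \<or> ?B p' \<inter> ?B p = {}"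
      using cells_nested[OF B' B] p p' by simp
    assume "?B p' \<subseteq> ?B p"
    then show "?A p' \<subseteq> ?R p"
      using cell_subset_re_if_offset_eq[OF A B A' B'] offset offset' p p' by simp
  qed (use assms in auto)
qed

definition offsets :: "nat \<Rightarrow> ('n \<Rightarrow> int) set" where
  "offsets N = (\<lambda>(n, A, B). offset (F n) B A) ` (SIGMA n:{1..N}. cells_at n \<times> cells_at n)"

lemma finite_offsets: "finite (offsets N)"
  unfolding offsets_def by (intro finite_imageI finite_pairs_of_cells)

lemma superlevel_subset_heavy_sets:
  assumes "0 \<le> r" "r < 1" "0 < t"
  shows "superlevel (r\<^sup>2) t N
    \<subseteq> (\<Union>k\<in>offsets N. heavy_set (lattice_sum_bound r CARD('n) / t * r ^ l1_norm k) k N)"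
proof
  let ?w = "\<lambda>k. lattice_sum_bound r CARD('n) / t * r ^ l1_norm k"
  fix x
  assume "x \<in> superlevel (r\<^sup>2) t N"
  then obtain n A where n: "n \<in> {1..N}" and A: "A \<in> cells_at n" "x \<in> A"
    and gt: "t < weighted_avg (r\<^sup>2) a b (F n) f A"
    by (auto simp: superlevel_def)
  obtain B where B: "B \<in> cells_at n"
    and heavy: "measure lebesgue (re (B \<union> A)) \<le> ?w (offset (F n) B A) * mass B"
    using interval_algebra_product.ex_heavy_cell_if_weighted_avg_gt[OF algebra_at assms gt] n
    by (auto simp: atom_dist_eq_l1_norm_offset)
  have "offset (F n) B A \<in> offsets N"
    unfolding offsets_def using n A(1) B by force
  moreover have "x \<in> heavy_set (?w (offset (F n) B A)) (offset (F n) B A) N"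
    unfolding heavy_set_def heavy_pairs_def using n A B heavy by blast
  ultimately show "x \<in> (\<Union>k\<in>offsets N. heavy_set (?w k) k N)"
    by blast
qed

lemma measure_superlevel_le:
  assumes "0 \<le> r" "r < 1" "0 < t"
  shows "measure lebesgue (superlevel (r\<^sup>2) t N)
    \<le> (lattice_sum_bound r CARD('n))\<^sup>2 / t * mass (cube a b)"
proof -
  define S where "S = lattice_sum_bound r CARD('n)"
  have "0 < S"
    unfolding S_def by (rule lattice_sum_bound_pos[OF assms(2)])
  let ?w = "\<lambda>k. S / t * r ^ l1_norm k"
  have "measure lebesgue (superlevel (r\<^sup>2) t N) \<le> measure lebesgue (\<Union>k\<in>offsets N. heavy_set (?w k) k N)"
    using superlevel_subset_heavy_sets[OF assms, folded S_def] lmeasurable_superlevel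
    by (rule measure_mono_fmeasurable[OF _ fmeasurableD])
      (intro fmeasurable.finite_UN finite_offsets lmeasurable_heavy_set)
  also have "\<dots> \<le> (\<Sum>k\<in>offsets N. measure lebesgue (heavy_set (?w k) k N))"
    using finite_offsets lmeasurable_heavy_set by (intro measure_UNION_le) auto
  also have "\<dots> \<le> (\<Sum>k\<in>offsets N. ?w k * mass (cube a b))"
    using assms \<open>0 < S\<close> by (intro sum_mono measure_heavy_set_le) auto
  also have "\<dots> = S / t * mass (cube a b) * (\<Sum>k\<in>offsets N. r ^ l1_norm k)"
    by (simp add: sum_distrib_left sum_divide_distrib mult_ac)
  also have "\<dots> \<le> S / t * mass (cube a b) * S"
  proof (rule mult_left_mono)
    show "(\<Sum>k\<in>offsets N. r ^ l1_norm k) \<le> S"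
      unfolding S_def by (rule sum_power_l1_norm_le[OF assms(1,2) finite_offsets])
    show "0 \<le> S / t * mass (cube a b)"
      using \<open>0 < S\<close> \<open>0 < t\<close> mass_nonneg by simp
  qed
  finally show ?thesis
    by (simp add: S_def power2_eq_square mult_ac)
qed

lemma superlevel_Suc_subset: "superlevel q t N \<subseteq> superlevel q t (Suc N)"
  unfolding superlevel_def by (intro UN_mono) auto

lemma maximal_fun_superlevel_eq:
  assumes "0 \<le> t"
  shows "{x \<in> cube a b. ennreal t < maximal_fun q a b F f x} = (\<Union>N. superlevel q t N)"
proof (rule set_eqI)
  fix x
  have at_level: "x \<in> cube a b \<and>
        t < weighted_avg q a b (F n) f (atom_at (prod_sigma_algebra a b (F n)) x)
      \<longleftrightarrow> (\<exists>A\<in>cells_at n. x \<in> A \<and> t < weighted_avg q a b (F n) f A)" if "1 \<le> n" for n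
    by (rule interval_algebra_product.cube_and_atom_at_iff[OF algebra_at[OF that]])
  have "x \<in> {x \<in> cube a b. ennreal t < maximal_fun q a b F f x} \<longleftrightarrow> (\<exists>n\<ge>1. x \<in> cube a b \<and>
      t < weighted_avg q a b (F n) f (atom_at (prod_sigma_algebra a b (F n)) x))"
    using assms unfolding maximal_fun_def weighted_avg_def less_SUP_iff
    by (auto simp: ennreal_less_iff)
  also have "\<dots> \<longleftrightarrow> (\<exists>n\<ge>1. \<exists>A\<in>cells_at n. x \<in> A \<and> t < weighted_avg q a b (F n) f A)"
    using at_level by blast
  also have "\<dots> \<longleftrightarrow> x \<in> (\<Union>N. superlevel q t N)"
    unfolding superlevel_def by fastforce
  finally show "x \<in> {x \<in> cube a b. ennreal t < maximal_fun q a b F f x} \<longleftrightarrow> x \<in> (\<Union>N. superlevel q t N)" .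
qed

lemma maximal_fun_weak_type:
  assumes "0 \<le> r" "r < 1" "0 < t"
  shows "{x \<in> cube a b. ennreal t < maximal_fun (r\<^sup>2) a b F f x} \<in> sets lebesgue"
    and "emeasure lebesgue {x \<in> cube a b. ennreal t < maximal_fun (r\<^sup>2) a b F f x}
      \<le> ennreal ((lattice_sum_bound r CARD('n))\<^sup>2 / t * mass (cube a b))"
proof -
  let ?E = "superlevel (r\<^sup>2) t"
  have level_set: "{x \<in> cube a b. ennreal t < maximal_fun (r\<^sup>2) a b F f x} = (\<Union>N. ?E N)"
    using assms(3) by (intro maximal_fun_superlevel_eq) simp
  note bound = measure_superlevel_le[OF assms]
  note nested_Union = lmeasurable_superlevel bound superlevel_Suc_subset
  have Union: "(\<Union>N. ?E N) \<in> lmeasurable"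
    by (rule measurable_nested_Union[of ?E, OF nested_Union])
  have "(\<lambda>N. measure lebesgue (?E N)) \<longlonglongrightarrow> measure lebesgue (\<Union>N. ?E N)"
    by (rule measure_nested_Union[of ?E, OF nested_Union])
  then have "measure lebesgue (\<Union>N. ?E N) \<le> (lattice_sum_bound r CARD('n))\<^sup>2 / t * mass (cube a b)"
    using bound by (intro LIMSEQ_le_const2) auto
  then show "{x \<in> cube a b. ennreal t < maximal_fun (r\<^sup>2) a b F f x} \<in> sets lebesgue"
    "emeasure lebesgue {x \<in> cube a b. ennreal t < maximal_fun (r\<^sup>2) a b F f x}
      \<le> ennreal ((lattice_sum_bound r CARD('n))\<^sup>2 / t * mass (cube a b))"
    using Union by (simp_all add: level_set fmeasurableD emeasure_eq_measure2 ennreal_leI)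
qed

end

theorem proposition3p1:
  fixes q :: real
  assumes "0 \<le> q" and "q < 1"
  shows "\<exists>C::real. \<forall>(a::real) (b::real) (F :: nat \<Rightarrow> 'n::finite \<Rightarrow> real set set) (f :: real^'n \<Rightarrow> real).
           a < b \<longrightarrow> interval_filtration a b F \<longrightarrow> set_integrable lebesgue (cube a b) f \<longrightarrow>
           (\<forall>t::real. t > 0 \<longrightarrow>
              {x \<in> cube a b. maximal_fun q a b F f x > ennreal t} \<in> sets lebesgue \<and>
              emeasure lebesgue {x \<in> cube a b. maximal_fun q a b F f x > ennreal t}
                \<le> ennreal (C / t * (LINT y:cube a b|lebesgue. \<bar>f y\<bar>)))"
proof (intro exI allI impI)
  fix a b t :: real and F :: "nat \<Rightarrow> 'n \<Rightarrow> real set set" and f :: "real^'n \<Rightarrow> real"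
  assume "interval_filtration a b F" "set_integrable lebesgue (cube a b) f" "0 < t"
  then interpret integrable_on_filtered_cube a b F f
    by unfold_locales
  have "0 \<le> sqrt q" "sqrt q < 1" "(sqrt q)\<^sup>2 = q"
    using assms by simp_all
  then show "{x \<in> cube a b. maximal_fun q a b F f x > ennreal t} \<in> sets lebesgue \<and>
      emeasure lebesgue {x \<in> cube a b. maximal_fun q a b F f x > ennreal t}
        \<le> ennreal ((lattice_sum_bound (sqrt q) CARD('n))\<^sup>2 / t * (LINT y:cube a b|lebesgue. \<bar>f y\<bar>))"
    using maximal_fun_weak_type[of "sqrt q" t] \<open>0 < t\<close> by simp
qed

end
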